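(* Let $G$ be a finite simple graph with vertex set $V(G)=\{1,\dots,n\}$ and diameter at most $2$. Let $\mathrm{k}$ be a field, $S=\mathrm{k}[x_1,\dots,x_n]$, $\mathfrak m=(x_1,\dots,x_n)$, and let $NI(G)\subseteq S$ denote the closed neighborhood ideal of $G$. Then $\mathfrak m$ is an associated prime of $S/NI(G)^2$ if and only if $G$ is vertex diameter-$2$-critical.
   Context: For a vertex $i$ of $G$, $N_G(i)=\{j : \{i,j\}\in E(G)\}$ and $N_G[i]=N_G(i)\cup\{i\}$. For $W\subseteq\{1,\dots,n\}$, $x_W=\prod_{j\in W}x_j$. The closed neighborhood ideal of $G$ is $NI(G)=(x_{N_G[i]} \mid i=1,\dots,n)\subseteq S$. The distance $\mathrm{dist}_G(u,v)$ is the length of a shortest path in $G$ connecting $u$ and $v$, and is $\infty$ if there is no such path; the diameter $\mathrm{diam}(G)$ is the maximum distance between any two vertices of $G$. For a vertex $x\in V(G)$, $G-x$ is the subgraph of $G$ obtained by removing $x$ and all edges incident to $x$. A simple connected graph $G$ with $\mathrm{diam}(G)=d$ is called vertex diameter-$d$-critical if $\mathrm{diam}(G-x)\ge d+1$ for every $x\in V(G)$. A prime ideal $P$ of a Noetherian ring $R$ is an associated prime of a finitely generated $R$-module $M$ if $P=\mathrm{Ann}(y)$ for some $y\in M$.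
   Formalization: The formal theorem assumes n ≥ 2; for n = 1 the claim fails, since for G = K_1 the ideal m = (x_1) is an associated prime of S/(x_1^2) while diam(K_1) = 0, so K_1 is not vertex diameter-2-critical (n = 0 fails likewise). *)

theory Defs
  imports
    "HOL-Library.Poly_Mapping"
    "HOL-Algebra.QuotRing"
    "HOL-Algebra.Ideal_Product"
    "HOL-Algebra.Module"
    "Graph_Theory.Graph_Theory"
begin

section \<open>Graphs\<close>

text \<open>
  Finite simple graphs are the symmetric digraphs of the locale \<^locale>\<open>graph\<close>: finite, without
  loops and parallel arcs, an edge \<open>{i, j}\<close> being represented by the two arcs \<open>(i, j)\<close> and \<open>(j, i)\<close>.
\<close>

definition nbhd :: "('v, 'e) pre_digraph \<Rightarrow> 'v \<Rightarrow> 'v set" where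
  "nbhd G i = {j. i \<rightarrow>\<^bsub>G\<^esub> j}"

definition closed_nbhd :: "('v, 'e) pre_digraph \<Rightarrow> 'v \<Rightarrow> 'v set" where
  "closed_nbhd G i = nbhd G i \<union> {i}"

text \<open>An arc path is the list of its arcs. The infimum over the empty set is \<open>\<infinity>\<close>.\<close>

definition gdist :: "('v, 'e) pre_digraph \<Rightarrow> 'v \<Rightarrow> 'v \<Rightarrow> enat" where
  "gdist G u v = (INF p \<in> {p. pre_digraph.apath G u p v}. enat (length p))"

definition gdiam :: "('v, 'e) pre_digraph \<Rightarrow> enat" where
  "gdiam G = (SUP u \<in> verts G. SUP v \<in> verts G. gdist G u v)"

definition vertex_diameter_critical :: "nat \<Rightarrow> ('v, 'e) pre_digraph \<Rightarrow> bool" where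
  "vertex_diameter_critical d G \<longleftrightarrow>
     graph G \<and> connected G \<and> gdiam G = enat d \<and>
     (\<forall>x \<in> verts G. gdiam (pre_digraph.del_vert G x) \<ge> enat (d + 1))"


section \<open>Polynomial rings\<close>

text \<open>
  A monomial is its finitely supported exponent function, a polynomial its finitely supported
  coefficient function on monomials. The carrier consists of the polynomials all of whose
  monomials involve only variables \<open>x\<^sub>i\<close> with \<open>i \<in> V\<close>.
\<close>

type_synonym 'k polynomial = "(nat \<Rightarrow>\<^sub>0 nat) \<Rightarrow>\<^sub>0 'k"

definition polynomial_ring :: "nat set \<Rightarrow> ('k::field) polynomial ring" where
  "polynomial_ring V =
     \<lparr>carrier = {p. \<forall>m \<in> Poly_Mapping.keys p. Poly_Mapping.keys m \<subseteq> V},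
      monoid.mult = (*), one = 1, zero = 0, add = (+)\<rparr>"

definition pvar :: "nat \<Rightarrow> ('k::field) polynomial" where
  "pvar i = Poly_Mapping.single (Poly_Mapping.single i 1) 1"

definition pvar_prod :: "nat set \<Rightarrow> ('k::field) polynomial" where
  "pvar_prod W = (\<Prod>j\<in>W. pvar j)"

definition closed_nbhd_ideal :: "(nat, 'e) pre_digraph \<Rightarrow> ('k::field) polynomial set" where
  "closed_nbhd_ideal G =
     Idl\<^bsub>polynomial_ring (verts G)\<^esub> ((\<lambda>i. pvar_prod (closed_nbhd G i)) ` verts G)"


section \<open>Associated primes\<close>

definition annihilator :: "('a, 'm) ring_scheme \<Rightarrow> ('a, 'b, 'n) module_scheme \<Rightarrow> 'b \<Rightarrow> 'a set" where
  "annihilator R M y = {r \<in> carrier R. r \<odot>\<^bsub>M\<^esub> y = \<zero>\<^bsub>M\<^esub>}"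

definition associated_prime ::
    "('a, 'm) ring_scheme \<Rightarrow> ('a, 'b, 'n) module_scheme \<Rightarrow> 'a set \<Rightarrow> bool" where
  "associated_prime R M P \<longleftrightarrow> primeideal P R \<and> (\<exists>y \<in> carrier M. P = annihilator R M y)"

text \<open>\<open>R/I\<close> as an \<open>R\<close>-module: \<open>r\<close> acts as multiplication by its residue class.\<close>

definition quotient_module :: "('a, 'm) ring_scheme \<Rightarrow> 'a set \<Rightarrow> ('a, 'a set) module" where
  "quotient_module R I =
     \<lparr>carrier = carrier (R Quot I), monoid.mult = monoid.mult (R Quot I), one = one (R Quot I),
      zero = zero (R Quot I), add = add (R Quot I),
      smult = (\<lambda>r X. (I +>\<^bsub>R\<^esub> r) \<otimes>\<^bsub>R Quot I\<^esub> X)\<rparr>"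


section \<open>Sanity checks\<close>

lemma polynomial_ring_cring: "cring (polynomial_ring V :: ('k::field) polynomial ring)"
proof (rule cringI)
  let ?S = "polynomial_ring V :: 'k polynomial ring"
  have add: "p + q \<in> carrier ?S" if "p \<in> carrier ?S" "q \<in> carrier ?S" for p q
    using that Poly_Mapping.keys_add[of p q] by (fastforce simp: polynomial_ring_def)
  have neg: "- p \<in> carrier ?S" if "p \<in> carrier ?S" for p
    using that by (simp add: polynomial_ring_def)
  have mult: "p * q \<in> carrier ?S" if p: "p \<in> carrier ?S" and q: "q \<in> carrier ?S" for p q
  proof -
    have "Poly_Mapping.keys m \<subseteq> V" if "m \<in> Poly_Mapping.keys (p * q)" for m
    proof -
      from that obtain a b where
        "m = a + b" "a \<in> Poly_Mapping.keys p" "b \<in> Poly_Mapping.keys q"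
        using Poly_Mapping.keys_mult[of p q] by blast
      thus ?thesis
        using p q Poly_Mapping.keys_add[of a b] by (fastforce simp: polynomial_ring_def)
    qed
    thus ?thesis by (simp add: polynomial_ring_def)
  qed
  have zero: "0 \<in> carrier ?S" and one: "1 \<in> carrier ?S"
    by (simp_all add: polynomial_ring_def)
  have ops: "p \<oplus>\<^bsub>?S\<^esub> q = p + q" "p \<otimes>\<^bsub>?S\<^esub> q = p * q" "\<zero>\<^bsub>?S\<^esub> = 0" "\<one>\<^bsub>?S\<^esub> = 1" for p q
    by (simp_all add: polynomial_ring_def)
  show "abelian_group ?S"
  proof (rule abelian_groupI, unfold ops)
    fix p assume "p \<in> carrier ?S"
    thus "\<exists>q\<in>carrier ?S. q + p = 0"
      by (intro bexI[of _ "- p"] neg) simp_all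
  qed (simp_all add: add zero ac_simps)
  show "comm_monoid ?S"
    by (rule comm_monoidI, unfold ops) (simp_all add: mult one mult.assoc mult.commute)
  show "(p \<oplus>\<^bsub>?S\<^esub> q) \<otimes>\<^bsub>?S\<^esub> r = p \<otimes>\<^bsub>?S\<^esub> r \<oplus>\<^bsub>?S\<^esub> q \<otimes>\<^bsub>?S\<^esub> r" for p q r
    unfolding ops by (rule distrib_right)
qed

lemma quotient_module_module:
  assumes R: "cring R" and I: "ideal I R"
  shows "Module.module R (quotient_module R I)"
proof -
  interpret R: cring R by fact
  interpret I: ideal I R by fact
  interpret Q: cring "R Quot I" using I.quotient_is_cring[OF R] .
  interpret h: ring_hom_ring R "R Quot I" "(+>\<^bsub>R\<^esub>) I" by (rule I.rcos_ring_hom_ring)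
  note unf = quotient_module_def ring.simps monoid.simps partial_object.simps module.simps
  show ?thesis
  proof (rule moduleI)
    show "abelian_group (quotient_module R I)"
    proof (rule abelian_groupI, unfold unf)
      fix x assume "x \<in> carrier (R Quot I)"
      thus "\<exists>y\<in>carrier (R Quot I). y \<oplus>\<^bsub>R Quot I\<^esub> x = \<zero>\<^bsub>R Quot I\<^esub>"
        using Q.l_neg Q.a_inv_closed by blast
    qed (rule Q.a_closed Q.zero_closed Q.a_assoc Q.a_comm Q.l_zero; assumption)+
    show "\<one>\<^bsub>R\<^esub> \<odot>\<^bsub>quotient_module R I\<^esub> x = x"
      if "x \<in> carrier (quotient_module R I)" for x
      using that unfolding unf h.hom_one by (rule Q.l_one)
    fix r s x y
    assume r: "r \<in> carrier R" and s: "s \<in> carrier R"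
      and "x \<in> carrier (quotient_module R I)" "y \<in> carrier (quotient_module R I)"
    hence x: "x \<in> carrier (R Quot I)" and y: "y \<in> carrier (R Quot I)"
      by (simp_all only: unf)
    note c = h.hom_closed[OF r] h.hom_closed[OF s] x y
    show "r \<odot>\<^bsub>quotient_module R I\<^esub> x \<in> carrier (quotient_module R I)"
      unfolding unf using c by blast
    show "(r \<oplus>\<^bsub>R\<^esub> s) \<odot>\<^bsub>quotient_module R I\<^esub> x =
          r \<odot>\<^bsub>quotient_module R I\<^esub> x \<oplus>\<^bsub>quotient_module R I\<^esub> s \<odot>\<^bsub>quotient_module R I\<^esub> x"
      unfolding unf h.hom_add[OF r s] by (rule Q.l_distr[OF c(1,2,3)])
    show "r \<odot>\<^bsub>quotient_module R I\<^esub> (x \<oplus>\<^bsub>quotient_module R I\<^esub> y) =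
          r \<odot>\<^bsub>quotient_module R I\<^esub> x \<oplus>\<^bsub>quotient_module R I\<^esub> r \<odot>\<^bsub>quotient_module R I\<^esub> y"
      unfolding unf by (rule Q.r_distr[OF c(3,4,1)])
    show "(r \<otimes>\<^bsub>R\<^esub> s) \<odot>\<^bsub>quotient_module R I\<^esub> x =
          r \<odot>\<^bsub>quotient_module R I\<^esub> (s \<odot>\<^bsub>quotient_module R I\<^esub> x)"
      unfolding unf h.hom_mult[OF r s] by (rule Q.m_assoc[OF c(1,2,3)])
  qed (fact R)
qed

end

theory Submission
  imports Defs
begin

text \<open>
  Write \<open>N[i]\<close> for closed neighborhoods and \<open>J\<close> for the square of the closed neighborhood ideal, which
  is generated by the monomials \<open>x\<^bsub>N[i]\<^esub> \<cdot> x\<^bsub>N[j]\<^esub>\<close>. Both sides of the equivalence say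
  that every vertex \<open>k\<close> is the only common point of two closed neighborhoods:
  \<open>N[i] \<inter> N[j] = {k}\<close> for some \<open>i\<close> and \<open>j\<close>.

  On the algebraic side, \<open>J\<close> is a monomial ideal, so the maximal ideal \<open>(x\<^sub>1, \<dots>, x\<^sub>n)\<close> is associated
  to \<open>S/J\<close> if and only if there is a socle monomial: one outside \<open>J\<close> all of whose multiples by a
  variable are in \<open>J\<close> (\<open>maximal_ideal_associated_iff\<close>). Diameter at most two means that any two closed
  neighborhoods meet. A comparison of exponents then shows that a socle monomial forces the condition
  above, and that under this condition the product of all variables is one
  (\<open>exists_socle_exponent_iff\<close>).

  On the side of graphs, the distance of \<open>i\<close> and \<open>j\<close> in \<open>G - k\<close> exceeds two if and only if \<open>N[i]\<close> and
  \<open>N[j]\<close> do not meet outside \<open>k\<close>. As they do meet in \<open>G\<close>, this is again the condition above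
  (\<open>vertex_diameter_2_critical_iff\<close>).
\<close>

section \<open>Graphs of diameter at most two\<close>

text \<open>
  Distances are natural numbers or infinite, so the infimum is attained when it is finite.
\<close>

lemma gdist_le_iff:
  "gdist G u v \<le> enat d \<longleftrightarrow> (\<exists>p. pre_digraph.apath G u p v \<and> length p \<le> d)"
proof -
  have "gdist G u v \<le> enat d \<longleftrightarrow> gdist G u v < enat (Suc d)"
    by (cases "gdist G u v") auto
  also have "\<dots> \<longleftrightarrow> (\<exists>p. pre_digraph.apath G u p v \<and> length p \<le> d)"
    unfolding gdist_def INF_less_iff by auto
  finally show ?thesis .
qed

lemma gdiam_le_iff:
  "gdiam G \<le> c \<longleftrightarrow> (\<forall>u \<in> verts G. \<forall>v \<in> verts G. gdist G u v \<le> c)"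
  by (simp add: gdiam_def SUP_le_iff)

lemma adj_iff: "u \<rightarrow>\<^bsub>G\<^esub> v \<longleftrightarrow> (\<exists>e \<in> arcs G. tail G e = u \<and> head G e = v)"
  by (auto simp: arcs_ends_def arc_to_ends_def)

lemma closed_nbhd_self: "u \<in> closed_nbhd G u"
  by (simp add: closed_nbhd_def)

lemma closed_nbhd_arc: "e \<in> arcs G \<Longrightarrow> head G e \<in> closed_nbhd G (tail G e)"
  by (auto simp: closed_nbhd_def nbhd_def adj_iff)

lemma closed_nbhd_arcE:
  assumes "w \<in> closed_nbhd G u" "u \<noteq> w"
  obtains e where "e \<in> arcs G" "tail G e = u" "head G e = w"
  using assms by (auto simp: closed_nbhd_def nbhd_def adj_iff)

lemma closed_nbhd_sym:
  assumes "sym_digraph G"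
  shows "v \<in> closed_nbhd G u \<longleftrightarrow> u \<in> closed_nbhd G v"
  using assms arcs_ends_symmetric[of G]
  by (auto simp: closed_nbhd_def nbhd_def sym_digraph_def sym_digraph_axioms_def)

lemma closed_nbhd_subset:
  assumes "wf_digraph G" "u \<in> verts G"
  shows "closed_nbhd G u \<subseteq> verts G"
proof -
  interpret wf_digraph G by fact
  show ?thesis using assms(2) by (auto simp: closed_nbhd_def nbhd_def adj_iff)
qed

lemma gdist_le_1_imp_closed_nbhd:
  assumes "wf_digraph G" "gdist G u v \<le> 1"
  shows "v \<in> closed_nbhd G u"
proof -
  interpret wf_digraph G by fact
  obtain p where "apath u p v" "length p \<le> 1"
    using assms(2) gdist_le_iff[of G u v 1] by (auto simp: one_enat_def)
  thus ?thesis
    by (cases p) (auto simp: apath_simps closed_nbhd_def nbhd_def adj_iff)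
qed

text \<open>
  The middle vertex of a path of length two lies in both closed neighborhoods; shorter paths are
  covered because closed neighborhoods contain their centers.
\<close>

lemma gdist_le_2_iff:
  assumes "sym_digraph G" "u \<in> verts G" "v \<in> verts G"
  shows "gdist G u v \<le> 2 \<longleftrightarrow> closed_nbhd G u \<inter> closed_nbhd G v \<noteq> {}"
proof
  interpret sym_digraph G by fact
  assume "gdist G u v \<le> 2"
  then obtain p where p: "apath u p v" "length p \<le> 2"
    using gdist_le_iff[of G u v 2] by (auto simp: numeral_eq_enat)
  then consider "p = []" | e where "p = [e]" | e e' where "p = [e, e']"
    by (auto simp: le_Suc_eq numeral_2_eq_2 length_Suc_conv)
  hence "\<exists>w. w \<in> closed_nbhd G u \<and> v \<in> closed_nbhd G w"
    using p closed_nbhd_arc closed_nbhd_self by cases (fastforce simp: apath_simps)+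
  thus "closed_nbhd G u \<inter> closed_nbhd G v \<noteq> {}"
    using closed_nbhd_sym[OF assms(1)] by blast
next
  interpret sym_digraph G by fact
  assume "closed_nbhd G u \<inter> closed_nbhd G v \<noteq> {}"
  then obtain w where w: "w \<in> closed_nbhd G u" "v \<in> closed_nbhd G w"
    using closed_nbhd_sym[OF assms(1)] by blast
  have "\<exists>p. apath u p v \<and> length p \<le> 2"
  proof (cases "u = v")
    case True
    thus ?thesis using assms by (intro exI[of _ "[]"]) (auto simp: apath_simps)
  next
    case uv: False
    show ?thesis
    proof (cases "u = w \<or> w = v")
      case True
      then obtain e where "e \<in> arcs G" "tail G e = u" "head G e = v"
        using w uv by (metis closed_nbhd_arcE)
      thus ?thesis using uv by (intro exI[of _ "[e]"]) (auto simp: apath_simps)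
    next
      case False
      then obtain e e' where "e \<in> arcs G" "tail G e = u" "head G e = w"
          "e' \<in> arcs G" "tail G e' = w" "head G e' = v"
        using w by (metis closed_nbhd_arcE)
      thus ?thesis using uv False by (intro exI[of _ "[e, e']"]) (auto simp: apath_simps)
    qed
  qed
  thus "gdist G u v \<le> 2" using gdist_le_iff[of G u v 2] by (simp add: numeral_eq_enat)
qed

lemma gdiam_le_2_iff:
  assumes "sym_digraph G"
  shows "gdiam G \<le> 2 \<longleftrightarrow>
    (\<forall>u \<in> verts G. \<forall>v \<in> verts G. closed_nbhd G u \<inter> closed_nbhd G v \<noteq> {})"
  using gdist_le_2_iff[OF assms] by (simp add: gdiam_le_iff)

lemma adj_del_vert_iff:
  "u \<rightarrow>\<^bsub>pre_digraph.del_vert G x\<^esub> v \<longleftrightarrow> u \<rightarrow>\<^bsub>G\<^esub> v \<and> u \<noteq> x \<and> v \<noteq> x"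
  unfolding adj_iff pre_digraph.arcs_del_vert pre_digraph.tail_del_vert pre_digraph.head_del_vert
  by blast

lemma sym_digraph_del_vert:
  assumes "sym_digraph G"
  shows "sym_digraph (pre_digraph.del_vert G x)"
proof -
  interpret sym_digraph G by fact
  have "symmetric (del_vert x)"
    unfolding symmetric_def
  proof (rule symI)
    fix u v assume "u \<rightarrow>\<^bsub>del_vert x\<^esub> v"
    thus "v \<rightarrow>\<^bsub>del_vert x\<^esub> u"
      using arcs_ends_symmetric[OF sym_arcs] unfolding adj_del_vert_iff by blast
  qed
  thus ?thesis
    using wf_digraph_del_vert by (simp add: sym_digraph_def sym_digraph_axioms_def)
qed

lemma closed_nbhd_del_vert:
  assumes "u \<noteq> x"
  shows "closed_nbhd (pre_digraph.del_vert G x) u = closed_nbhd G u - {x}"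
  using assms by (auto simp: closed_nbhd_def nbhd_def adj_del_vert_iff)

lemma connected_if_gdiam_finite:
  assumes "wf_digraph G" "verts G \<noteq> {}" "gdiam G \<le> enat d"
  shows "connected G"
proof -
  interpret wf_digraph G by fact
  have "u \<rightarrow>\<^sup>*\<^bsub>mk_symmetric G\<^esub> v" if "u \<in> verts G" "v \<in> verts G" for u v
  proof -
    have "gdist G u v \<le> enat d"
      using assms(3) that by (simp add: gdiam_le_iff)
    then obtain p where "apath u p v"
      by (auto simp: gdist_le_iff)
    hence "u \<rightarrow>\<^sup>*\<^bsub>G\<^esub> v" by (auto simp: apath_def intro: reachable_awalkI)
    thus ?thesis by (rule reachable_mk_symmetricI)
  qed
  thus ?thesis using assms(2) by (simp add: connected_def strongly_connected_def)
qed

text \<open>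
  Closed neighborhoods pairwise meet because the diameter is at most two. Deleting \<open>x\<close> deletes \<open>x\<close>
  from the closed neighborhoods of the other vertices, so \<open>u\<close> and \<open>v\<close> end up at distance at least
  three exactly if \<open>x\<close> was the only common point. It remains to see that such \<open>u\<close> and \<open>v\<close> survive
  the deletion, that is, differ from \<open>x\<close>. They are distinct, as \<open>N[u] = {u}\<close> would isolate \<open>u\<close>; they
  are not adjacent, as both would then be common points; and if \<open>x\<close> were one of them, it would be a
  neighbor of the other. Nonadjacency also yields that the diameter is two and not less.
\<close>

lemma vertex_diameter_2_critical_iff:
  assumes G: "graph G" and two: "u0 \<in> verts G" "v0 \<in> verts G" "u0 \<noteq> v0"
    and diam: "gdiam G \<le> 2"
  shows "vertex_diameter_critical 2 G \<longleftrightarrow>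
    (\<forall>x \<in> verts G. \<exists>u \<in> verts G. \<exists>v \<in> verts G. closed_nbhd G u \<inter> closed_nbhd G v = {x})"
    (is "?L \<longleftrightarrow> ?R")
proof -
  interpret graph G by fact
  have sym: "sym_digraph G" and wf: "wf_digraph G" by unfold_locales
  note cn_sym = closed_nbhd_sym[OF sym]
  have meet: "closed_nbhd G u \<inter> closed_nbhd G v \<noteq> {}" if "u \<in> verts G" "v \<in> verts G" for u v
    using diam that gdiam_le_2_iff[OF sym] by blast
  note self = closed_nbhd_self[of _ G]
  have sep: "u \<noteq> v \<and> v \<notin> closed_nbhd G u \<and> u \<noteq> x \<and> v \<noteq> x"
    if "u \<in> verts G" "v \<in> verts G" "closed_nbhd G u \<inter> closed_nbhd G v = {x}" for u v x
  proof -
    have ne: "u \<noteq> v"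
    proof
      assume "u = v"
      hence "closed_nbhd G u = {u}" using that(3) self[of u] by auto
      moreover obtain w where "w \<in> verts G" "w \<noteq> u" using two by (cases "u = u0") auto
      ultimately show False using meet[of u w] that(1) cn_sym[of u w] by auto
    qed
    moreover have "v \<notin> closed_nbhd G u"
      using that(3) self[of u] self[of v] cn_sym[of u v] ne by (metis IntI singletonD)
    ultimately show ?thesis
      using that(3) self[of u] self[of v] cn_sym[of u v] by (metis IntD1 IntD2 singletonI)
  qed
  have del: "gdiam (pre_digraph.del_vert G x) \<ge> enat (2 + 1) \<longleftrightarrow>
      (\<exists>u \<in> verts G. \<exists>v \<in> verts G. closed_nbhd G u \<inter> closed_nbhd G v = {x})" if x: "x \<in> verts G" for x
  proof -
    let ?H = "pre_digraph.del_vert G x"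
    have "gdiam ?H \<ge> enat (2 + 1) \<longleftrightarrow> \<not> gdiam ?H \<le> 2"
      by (cases "gdiam ?H") (auto simp: numeral_eq_enat)
    also have "\<dots> \<longleftrightarrow> (\<exists>u \<in> verts G - {x}. \<exists>v \<in> verts G - {x}.
        (closed_nbhd G u - {x}) \<inter> (closed_nbhd G v - {x}) = {})"
      unfolding gdiam_le_2_iff[OF sym_digraph_del_vert[OF sym]] verts_del_vert
      by (auto simp: closed_nbhd_del_vert)
    also have "\<dots> \<longleftrightarrow> (\<exists>u \<in> verts G. \<exists>v \<in> verts G. closed_nbhd G u \<inter> closed_nbhd G v = {x})"
      (is "?A \<longleftrightarrow> ?B")
    proof
      assume ?A
      then obtain u v where "u \<in> verts G" "v \<in> verts G" "closed_nbhd G u \<inter> closed_nbhd G v \<subseteq> {x}"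
        by blast
      thus ?B using meet by (metis subset_singletonD)
    next
      assume ?B
      then obtain u v where uv: "u \<in> verts G" "v \<in> verts G" "closed_nbhd G u \<inter> closed_nbhd G v = {x}"
        by blast
      have "(closed_nbhd G u - {x}) \<inter> (closed_nbhd G v - {x}) = closed_nbhd G u \<inter> closed_nbhd G v - {x}"
        by blast
      also have "\<dots> = {}" by (simp add: uv(3))
      finally show ?A using sep[OF uv] uv(1,2) by (intro bexI[of _ u] bexI[of _ v]) simp_all
    qed
    finally show ?thesis .
  qed
  have "connected G"
    using connected_if_gdiam_finite[OF wf, of 2] diam two by (auto simp: numeral_eq_enat)
  moreover have "gdiam G = enat 2" if crit: ?R
  proof -
    obtain u v where uv: "u \<in> verts G" "v \<in> verts G" "closed_nbhd G u \<inter> closed_nbhd G v = {u0}"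
      using bspec[OF crit two(1)] by blast
    hence "\<not> gdist G u v \<le> 1" using sep[OF uv] gdist_le_1_imp_closed_nbhd[OF wf] by blast
    hence "\<not> gdiam G \<le> 1" using uv by (auto simp: gdiam_le_iff)
    thus ?thesis using diam by (cases "gdiam G") (auto simp: numeral_eq_enat one_enat_def)
  qed
  ultimately show ?thesis
    using del G by (auto simp: vertex_diameter_critical_def)
qed


section \<open>Monomial ideals\<close>

abbreviation exponent_le :: "(nat \<Rightarrow>\<^sub>0 nat) \<Rightarrow> (nat \<Rightarrow>\<^sub>0 nat) \<Rightarrow> bool" (infix "\<preceq>" 50) where
  "a \<preceq> b \<equiv> Poly_Mapping.lookup a \<le> Poly_Mapping.lookup b"

text \<open>
  The ideal generated by the monomials with exponents in \<open>B\<close> (see \<open>genideal_monomials\<close> below),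
  given by its membership test: each monomial of \<open>p\<close> has to be a multiple of a generator.
\<close>

definition monomial_ideal :: "nat set \<Rightarrow> (nat \<Rightarrow>\<^sub>0 nat) set \<Rightarrow> ('k::field) polynomial set" where
  "monomial_ideal V B =
     {p \<in> carrier (polynomial_ring V).
        \<forall>m \<in> Poly_Mapping.keys p. \<exists>b \<in> B. b \<preceq> m}"

lemma polynomial_ring_simps [simp]:
  "p \<in> carrier (polynomial_ring V) \<longleftrightarrow> (\<forall>m \<in> Poly_Mapping.keys p. Poly_Mapping.keys m \<subseteq> V)"
  "p \<otimes>\<^bsub>polynomial_ring V\<^esub> q = p * q"
  "p \<oplus>\<^bsub>polynomial_ring V\<^esub> q = p + q"
  "\<zero>\<^bsub>polynomial_ring V\<^esub> = 0"
  "\<one>\<^bsub>polynomial_ring V\<^esub> = 1"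
  by (simp_all add: polynomial_ring_def)

lemma lookup_single_times:
  fixes q :: "('a::cancel_comm_monoid_add) \<Rightarrow>\<^sub>0 ('k::comm_semiring_1)"
  shows "Poly_Mapping.lookup (Poly_Mapping.single m c * q) (m + a) = c * Poly_Mapping.lookup q a"
proof -
  have "Poly_Mapping.lookup (Poly_Mapping.single m c * q) (m + a) =
      (\<Sum>l. (c when m = l) * (\<Sum>b. Poly_Mapping.lookup q b when m + a = l + b))"
    by (simp add: lookup_mult lookup_single)
  also have "\<dots> = (\<Sum>l. (c * (\<Sum>b. Poly_Mapping.lookup q b when m + a = l + b)) when l = m)"
    by (intro Sum_any.cong) (auto simp: when_def)
  also have "\<dots> = c * Poly_Mapping.lookup q a" by simp
  finally show ?thesis .
qed

lemma exponent_le_imp_add: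
  fixes b m :: "nat \<Rightarrow>\<^sub>0 nat"
  assumes "b \<preceq> m"
  shows "m = b + (m - b)"
  using assms by (intro poly_mapping_eqI) (simp add: lookup_add lookup_minus le_fun_def)

text \<open>
  A polynomial is the sum of its terms, and scalars belong to the ring; so an ideal containing all
  monomials of a polynomial contains the polynomial. This is how membership in an ideal is
  reduced to exponents.
\<close>

lemma mem_ideal_if_monomials_mem:
  fixes p :: "('k::field) polynomial"
  assumes J: "ideal J (polynomial_ring V)" and p: "p \<in> carrier (polynomial_ring V)"
    and mono: "\<And>m. m \<in> Poly_Mapping.keys p \<Longrightarrow> Poly_Mapping.single m 1 \<in> J"
  shows "p \<in> J"
proof -
  interpret J: ideal J "polynomial_ring V" by fact
  have p_eq: "p = (\<Sum>m\<in>Poly_Mapping.keys p. Poly_Mapping.single m (Poly_Mapping.lookup p m))"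
    by (rule poly_mapping_eqI)
      (simp add: lookup_sum lookup_single when_def in_keys_iff)
  have monom: "Poly_Mapping.single m (Poly_Mapping.lookup p m) \<in> J" if "m \<in> Poly_Mapping.keys p" for m
  proof -
    have "Poly_Mapping.single 0 (Poly_Mapping.lookup p m) \<in> carrier (polynomial_ring V)" by simp
    from J.I_l_closed[OF mono[OF that] this] show ?thesis by (simp add: mult_single)
  qed
  have "(\<Sum>m\<in>A. Poly_Mapping.single m (Poly_Mapping.lookup p m)) \<in> J"
    if "finite A" "A \<subseteq> Poly_Mapping.keys p" for A
    using that
  proof (induction A rule: finite_induct)
    case empty
    show ?case using additive_subgroup.zero_closed[OF ideal.axioms(1)[OF J]] by simp
  next
    case (insert m A)
    thus ?case using monom additive_subgroup.a_closed[OF ideal.axioms(1)[OF J],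
        of "Poly_Mapping.single m (Poly_Mapping.lookup p m)"] by simp
  qed
  from this[OF finite_keys order.refl] show ?thesis using p_eq by simp
qed

lemma ideal_monomial_ideal:
  "ideal (monomial_ideal V B :: ('k::field) polynomial set) (polynomial_ring V)"
proof -
  let ?S = "polynomial_ring V :: 'k polynomial ring"
  interpret S: cring ?S by (rule polynomial_ring_cring)
  have uminus: "\<ominus>\<^bsub>?S\<^esub> p = - p" if "p \<in> carrier ?S" for p
    using that by (intro S.minus_equality) auto
  have mult: "q * p \<in> monomial_ideal V B"
    if p: "p \<in> monomial_ideal V B" and q: "q \<in> carrier ?S" for p q :: "'k polynomial"
  proof -
    have "q * p \<in> carrier ?S"
      using S.m_closed[of q p] p q unfolding monomial_ideal_def polynomial_ring_simps by blast
    moreover have "\<exists>b\<in>B. b \<preceq> m" if m: "m \<in> Poly_Mapping.keys (q * p)" for m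
    proof -
      obtain a c where "m = a + c" "c \<in> Poly_Mapping.keys p"
        using m Poly_Mapping.keys_mult[of q p] by blast
      moreover then obtain b where "b \<in> B" "b \<preceq> c"
        using p by (auto simp: monomial_ideal_def)
      ultimately show ?thesis
        by (intro bexI[of _ b]) (auto simp: le_fun_def lookup_add trans_le_add2)
    qed
    ultimately show ?thesis by (simp add: monomial_ideal_def)
  qed
  have add: "p + q \<in> monomial_ideal V B"
    if "p \<in> monomial_ideal V B" "q \<in> monomial_ideal V B" for p q :: "'k polynomial"
    using that Poly_Mapping.keys_add[of p q] unfolding monomial_ideal_def by fastforce
  show ?thesis
  proof (rule idealI)
    show "subgroup (monomial_ideal V B) (add_monoid ?S)"
    proof (rule subgroup.intro)
      show "monomial_ideal V B \<subseteq> carrier (add_monoid ?S)"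
        unfolding monomial_ideal_def by auto
      show "\<one>\<^bsub>add_monoid ?S\<^esub> \<in> monomial_ideal V B"
        by (simp add: monomial_ideal_def)
      show "p \<otimes>\<^bsub>add_monoid ?S\<^esub> q \<in> monomial_ideal V B"
        if "p \<in> monomial_ideal V B" "q \<in> monomial_ideal V B" for p q :: "'k polynomial"
        using add[OF that] by simp
      show "inv\<^bsub>add_monoid ?S\<^esub> p \<in> monomial_ideal V B"
        if p: "p \<in> monomial_ideal V B" for p :: "'k polynomial"
      proof -
        have "inv\<^bsub>add_monoid ?S\<^esub> p = - p"
          using uminus[of p] p unfolding a_inv_def monomial_ideal_def by blast
        thus ?thesis using p by (simp add: monomial_ideal_def)
      qed
    qed
    show "ring ?S" by (rule S.ring_axioms)
    show "q \<otimes>\<^bsub>?S\<^esub> p \<in> monomial_ideal V B" "p \<otimes>\<^bsub>?S\<^esub> q \<in> monomial_ideal V B"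
      if "p \<in> monomial_ideal V B" "q \<in> carrier ?S" for p q :: "'k polynomial"
      using mult[OF that] by (simp_all add: mult.commute)
  qed
qed

lemma single_mem_monomial_ideal_iff:
  "Poly_Mapping.single m (1::'k::field) \<in> monomial_ideal V B \<longleftrightarrow>
     Poly_Mapping.keys m \<subseteq> V \<and> (\<exists>b \<in> B. b \<preceq> m)"
  by (simp add: monomial_ideal_def)

lemma keys_minus_subset:
  fixes m b :: "nat \<Rightarrow>\<^sub>0 nat"
  shows "Poly_Mapping.keys (m - b) \<subseteq> Poly_Mapping.keys m"
  by (auto simp: in_keys_iff lookup_minus)

lemma genideal_monomials:
  assumes B: "\<And>b. b \<in> B \<Longrightarrow> Poly_Mapping.keys b \<subseteq> V"
  shows "Idl\<^bsub>polynomial_ring V\<^esub> ((\<lambda>b. Poly_Mapping.single b (1::'k::field)) ` B) = monomial_ideal V B"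
    (is "Idl\<^bsub>?S\<^esub> ?X = _")
proof
  interpret S: cring ?S by (rule polynomial_ring_cring)
  have X: "?X \<subseteq> carrier ?S" using B by auto
  show "Idl\<^bsub>?S\<^esub> ?X \<subseteq> monomial_ideal V B"
    by (rule S.genideal_minimal[OF ideal_monomial_ideal])
      (use B in \<open>auto simp: single_mem_monomial_ideal_iff\<close>)
  interpret I: ideal "Idl\<^bsub>?S\<^esub> ?X" ?S by (rule S.genideal_ideal[OF X])
  show "monomial_ideal V B \<subseteq> Idl\<^bsub>?S\<^esub> ?X"
  proof
    fix p :: "'k polynomial" assume p: "p \<in> monomial_ideal V B"
    show "p \<in> Idl\<^bsub>?S\<^esub> ?X"
    proof (rule mem_ideal_if_monomials_mem[OF I.ideal_axioms])
      show "p \<in> carrier ?S" using p by (simp add: monomial_ideal_def)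
      fix m assume m: "m \<in> Poly_Mapping.keys p"
      then obtain b where b: "b \<in> B" "b \<preceq> m"
        using p by (auto simp: monomial_ideal_def)
      have "Poly_Mapping.keys (m - b) \<subseteq> V"
        using keys_minus_subset[of m b] m p by (auto simp: monomial_ideal_def)
      hence "Poly_Mapping.single (m - b) 1 \<in> carrier ?S" by simp
      moreover have "Poly_Mapping.single b 1 \<in> Idl\<^bsub>?S\<^esub> ?X"
        using S.genideal_self[OF X] b(1) by blast
      ultimately have "Poly_Mapping.single b 1 \<otimes>\<^bsub>?S\<^esub> Poly_Mapping.single (m - b) 1 \<in> Idl\<^bsub>?S\<^esub> ?X"
        by (intro I.I_r_closed)
      thus "Poly_Mapping.single m 1 \<in> Idl\<^bsub>?S\<^esub> ?X"
        using exponent_le_imp_add[OF b(2)] by (simp add: mult_single)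
    qed
  qed
qed

lemma ideal_prod_monomial_ideals:
  assumes A: "\<And>a. a \<in> A \<Longrightarrow> Poly_Mapping.keys a \<subseteq> V"
    and B: "\<And>b. b \<in> B \<Longrightarrow> Poly_Mapping.keys b \<subseteq> V"
  shows "(monomial_ideal V A :: ('k::field) polynomial set) \<cdot>\<^bsub>polynomial_ring V\<^esub> monomial_ideal V B =
    monomial_ideal V {a + b | a b. a \<in> A \<and> b \<in> B}"
    (is "?I \<cdot>\<^bsub>?S\<^esub> ?J = monomial_ideal V ?C")
proof
  interpret S: cring ?S by (rule polynomial_ring_cring)
  interpret K: ideal "monomial_ideal V ?C :: 'k polynomial set" ?S by (rule ideal_monomial_ideal)
  show "?I \<cdot>\<^bsub>?S\<^esub> ?J \<subseteq> monomial_ideal V ?C"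
  proof
    fix p :: "'k polynomial" assume "p \<in> ?I \<cdot>\<^bsub>?S\<^esub> ?J"
    thus "p \<in> monomial_ideal V ?C"
    proof induction
      case (prod p q)
      have "\<exists>c\<in>?C. c \<preceq> m" if m: "m \<in> Poly_Mapping.keys (p * q)" for m
      proof -
        obtain x y where xy: "m = x + y" "x \<in> Poly_Mapping.keys p" "y \<in> Poly_Mapping.keys q"
          using m Poly_Mapping.keys_mult[of p q] by blast
        then obtain a b where "a \<in> A" "b \<in> B" "a \<preceq> x" "b \<preceq> y"
          using prod unfolding monomial_ideal_def by blast
        thus ?thesis
          by (intro bexI[of _ "a + b"]) (auto simp: xy(1) le_fun_def lookup_add add_mono)
      qed
      moreover have "p \<otimes>\<^bsub>?S\<^esub> q \<in> carrier ?S"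
        using prod by (intro S.m_closed) (auto simp: monomial_ideal_def)
      ultimately show ?case by (simp add: monomial_ideal_def)
    next
      case (sum p q)
      thus ?case using additive_subgroup.a_closed[OF ideal.axioms(1)[OF K.ideal_axioms]] by blast
    qed
  qed
  interpret IJ: ideal "?I \<cdot>\<^bsub>?S\<^esub> ?J" ?S
    by (intro S.ideal_prod_is_ideal ideal_monomial_ideal)
  have "(\<lambda>c. Poly_Mapping.single c (1::'k)) ` ?C \<subseteq> ?I \<cdot>\<^bsub>?S\<^esub> ?J"
  proof clarify
    fix a b assume ab: "a \<in> A" "b \<in> B"
    have "Poly_Mapping.single a (1::'k) \<otimes>\<^bsub>?S\<^esub> Poly_Mapping.single b 1 \<in> ?I \<cdot>\<^bsub>?S\<^esub> ?J"
      using ab A B by (intro ideal_prod.prod) (auto simp: single_mem_monomial_ideal_iff)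
    thus "Poly_Mapping.single (a + b) (1::'k) \<in> ?I \<cdot>\<^bsub>?S\<^esub> ?J" by (simp add: mult_single)
  qed
  hence "Idl\<^bsub>?S\<^esub> ((\<lambda>c. Poly_Mapping.single c (1::'k)) ` ?C) \<subseteq> ?I \<cdot>\<^bsub>?S\<^esub> ?J"
    by (rule S.genideal_minimal[OF IJ.ideal_axioms])
  moreover have "Poly_Mapping.keys c \<subseteq> V" if "c \<in> ?C" for c
  proof -
    obtain a b where ab: "c = a + b" "a \<in> A" "b \<in> B" using \<open>c \<in> ?C\<close> by blast
    show ?thesis using Poly_Mapping.keys_add[of a b] A[OF ab(2)] B[OF ab(3)] ab(1) by blast
  qed
  hence "Idl\<^bsub>?S\<^esub> ((\<lambda>c. Poly_Mapping.single c (1::'k)) ` ?C) = monomial_ideal V ?C"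
    by (rule genideal_monomials)
  ultimately show "monomial_ideal V ?C \<subseteq> ?I \<cdot>\<^bsub>?S\<^esub> ?J" by simp
qed

section \<open>Socle monomials and the ideal of the variables\<close>

lemma annihilator_quotient_module:
  assumes I: "ideal I R" and R: "cring R" and y: "y \<in> carrier R"
  shows "annihilator R (quotient_module R I) (I +>\<^bsub>R\<^esub> y) = {r \<in> carrier R. r \<otimes>\<^bsub>R\<^esub> y \<in> I}"
proof -
  interpret R: cring R by fact
  interpret I: ideal I R by fact
  have "I +>\<^bsub>R\<^esub> (r \<otimes>\<^bsub>R\<^esub> y) = I \<longleftrightarrow> r \<otimes>\<^bsub>R\<^esub> y \<in> I" if "r \<in> carrier R" for r
    using I.rcos_const_imp_mem[of "r \<otimes>\<^bsub>R\<^esub> y"] R.a_rcos_zero[OF I] that y by blast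
  thus ?thesis
    using y by (simp add: annihilator_def quotient_module_def FactRing_def I.rcoset_mult_add
        cong: conj_cong)
qed

lemma carrier_quotient_module:
  "carrier (quotient_module R I) = (+>\<^bsub>R\<^esub>) I ` carrier R"
  by (auto simp: quotient_module_def FactRing_def A_RCOSETS_def')

definition var_exponent :: "nat \<Rightarrow> nat \<Rightarrow>\<^sub>0 nat" where
  "var_exponent i = Poly_Mapping.single i 1"

lemma lookup_var_exponent: "Poly_Mapping.lookup (var_exponent i) j = (if i = j then 1 else 0)"
  by (simp add: var_exponent_def lookup_single when_def)

lemma keys_var_exponent: "Poly_Mapping.keys (var_exponent i) = {i}"
  by (simp add: var_exponent_def)

lemma var_exponent_le_iff:
  "var_exponent i \<preceq> m \<longleftrightarrow> i \<in> Poly_Mapping.keys m"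
  by (auto simp: le_fun_def lookup_var_exponent in_keys_iff Suc_le_eq)

lemma monomial_ideal_vars_eq:
  "monomial_ideal V (var_exponent ` V) =
     {p \<in> carrier (polynomial_ring V). Poly_Mapping.lookup p 0 = (0 :: 'k::field)}"
proof -
  have nonzero: "(\<exists>b \<in> var_exponent ` V. b \<preceq> m) \<longleftrightarrow> m \<noteq> 0"
    if "Poly_Mapping.keys m \<subseteq> V" for m
  proof -
    have "(\<exists>b \<in> var_exponent ` V. b \<preceq> m)
        \<longleftrightarrow> (\<exists>i \<in> V. i \<in> Poly_Mapping.keys m)"
      by (simp add: var_exponent_le_iff)
    also have "\<dots> \<longleftrightarrow> Poly_Mapping.keys m \<noteq> {}" using that by blast
    finally show ?thesis by simp
  qed
  have "(\<forall>m \<in> Poly_Mapping.keys p. \<exists>b \<in> var_exponent ` V. b \<preceq> m)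
      \<longleftrightarrow> Poly_Mapping.lookup p 0 = 0"
    if p: "p \<in> carrier (polynomial_ring V)" for p :: "'k polynomial"
  proof -
    have "(\<forall>m \<in> Poly_Mapping.keys p. \<exists>b \<in> var_exponent ` V. b \<preceq> m)
        \<longleftrightarrow> (\<forall>m \<in> Poly_Mapping.keys p. m \<noteq> 0)"
      using p by (intro ball_cong refl nonzero) simp
    also have "\<dots> \<longleftrightarrow> 0 \<notin> Poly_Mapping.keys p" by blast
    finally show ?thesis by (simp add: in_keys_iff)
  qed
  thus ?thesis
    unfolding monomial_ideal_def by (intro Collect_cong conj_cong refl)
qed

lemma genideal_vars:
  "Idl\<^bsub>polynomial_ring V\<^esub> (pvar ` V) =
     {p \<in> carrier (polynomial_ring V). Poly_Mapping.lookup p 0 = (0 :: 'k::field)}"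
proof -
  have vars: "pvar ` V = (\<lambda>b. Poly_Mapping.single b (1::'k)) ` var_exponent ` V"
    by (simp add: image_image pvar_def var_exponent_def)
  have keys: "Poly_Mapping.keys b \<subseteq> V" if "b \<in> var_exponent ` V" for b
    using that by (auto simp: keys_var_exponent)
  show ?thesis
    unfolding vars by (rule trans[OF genideal_monomials monomial_ideal_vars_eq]) (rule keys)
qed

text \<open>
  Exponents are natural numbers, so a sum of exponents vanishes only if both summands do. Taking
  the constant coefficient is therefore multiplicative, which makes the ideal of the variables prime.
\<close>

lemma lookup_times_zero:
  fixes p q :: "('k::field) polynomial"
  shows "Poly_Mapping.lookup (p * q) 0 = Poly_Mapping.lookup p 0 * Poly_Mapping.lookup q 0"
proof -
  define p' where "p' = p - Poly_Mapping.single 0 (Poly_Mapping.lookup p 0)"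
  have "0 \<notin> Poly_Mapping.keys p'" by (simp add: p'_def in_keys_iff lookup_minus)
  moreover have "a + b = 0 \<Longrightarrow> a = 0" for a b :: "nat \<Rightarrow>\<^sub>0 nat"
    by (metis add_eq_0_iff_both_eq_0 lookup_add lookup_zero poly_mapping_eqI)
  ultimately have "0 \<notin> Poly_Mapping.keys (p' * q)"
    using Poly_Mapping.keys_mult[of p' q] by fastforce
  moreover have "p * q = p' * q + Poly_Mapping.single 0 (Poly_Mapping.lookup p 0) * q"
    by (simp add: p'_def algebra_simps)
  ultimately show ?thesis
    using lookup_single_times[of 0 "Poly_Mapping.lookup p 0" q 0] by (simp add: lookup_add in_keys_iff)
qed

lemma primeideal_genideal_vars:
  "primeideal (Idl\<^bsub>polynomial_ring V\<^esub> (pvar ` V)) (polynomial_ring V :: ('k::field) polynomial ring)"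
proof (rule primeidealI)
  let ?S = "polynomial_ring V :: 'k polynomial ring"
  show "cring ?S" by (rule polynomial_ring_cring)
  then interpret S: cring ?S .
  show "ideal (Idl\<^bsub>?S\<^esub> (pvar ` V)) ?S"
    by (rule S.genideal_ideal) (auto simp: pvar_def)
  have "1 \<in> carrier ?S" "Poly_Mapping.lookup (1::'k polynomial) 0 \<noteq> 0"
    by (simp_all add: lookup_one)
  thus "carrier ?S \<noteq> Idl\<^bsub>?S\<^esub> (pvar ` V)" unfolding genideal_vars by blast
qed (auto simp: genideal_vars lookup_times_zero)

text \<open>
  If the ideal of the variables annihilates a class \<open>f\<close> modulo a monomial ideal and \<open>f\<close> is not in
  that ideal, then some monomial of \<open>f\<close> is outside it, and this monomial still enters the ideal when
  multiplied by any variable, because the membership test looks at each monomial separately.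
  Conversely, if \<open>m\<close> is such a monomial, then a multiple \<open>r \<cdot> m\<close> with \<open>r\<close> of nonzero constant
  coefficient has \<open>m\<close> itself among its monomials and stays outside the ideal. So only exponents
  have to be searched for a witness.
\<close>

lemma maximal_ideal_associated_iff:
  fixes S :: "('k::field) polynomial ring"
  assumes S: "S = polynomial_ring V"
  shows "associated_prime S (quotient_module S (monomial_ideal V B)) (Idl\<^bsub>S\<^esub> (pvar ` V)) \<longleftrightarrow>
    (\<exists>m. Poly_Mapping.keys m \<subseteq> V \<and> \<not> (\<exists>b \<in> B. b \<preceq> m) \<and>
         (\<forall>i \<in> V. \<exists>b \<in> B. b \<preceq> m + var_exponent i))"
    (is "?L \<longleftrightarrow> ?R")
proof -
  let ?I = "monomial_ideal V B :: 'k polynomial set"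
  have I: "ideal ?I S" unfolding S by (rule ideal_monomial_ideal)
  interpret S: cring S unfolding S by (rule polynomial_ring_cring)
  interpret I: ideal ?I S by fact
  note ann = annihilator_quotient_module[OF I S.is_cring]
  have "?L \<longleftrightarrow> (\<exists>f \<in> carrier S.
      Idl\<^bsub>S\<^esub> (pvar ` V) = annihilator S (quotient_module S ?I) (?I +>\<^bsub>S\<^esub> f))"
    using primeideal_genideal_vars[of V, where 'k = 'k]
    by (simp add: associated_prime_def carrier_quotient_module S)
  also have "\<dots> \<longleftrightarrow> (\<exists>f \<in> carrier S.
      {p \<in> carrier S. Poly_Mapping.lookup p 0 = 0} = {r \<in> carrier S. r * f \<in> ?I})"
  proof (intro bex_cong refl)
    fix f assume "f \<in> carrier S"
    thus "Idl\<^bsub>S\<^esub> (pvar ` V) = annihilator S (quotient_module S ?I) (?I +>\<^bsub>S\<^esub> f) \<longleftrightarrow>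
        {p \<in> carrier S. Poly_Mapping.lookup p 0 = 0} = {r \<in> carrier S. r * f \<in> ?I}"
      by (simp only: ann) (simp only: S genideal_vars polynomial_ring_simps)
  qed
  also have "\<dots> \<longleftrightarrow> ?R"
  proof
    assume "\<exists>f \<in> carrier S. {p \<in> carrier S. Poly_Mapping.lookup p 0 = 0} = {r \<in> carrier S. r * f \<in> ?I}"
    then obtain f where f: "f \<in> carrier S"
      and *: "\<And>r. r \<in> carrier S \<Longrightarrow> Poly_Mapping.lookup r 0 = 0 \<longleftrightarrow> r * f \<in> ?I" by blast
    have "f \<notin> ?I" using *[of 1] by (simp add: S lookup_one)
    then obtain m where m: "m \<in> Poly_Mapping.keys f" "\<not> (\<exists>b \<in> B. b \<preceq> m)"
      using f by (auto simp: monomial_ideal_def S)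
    have "\<exists>b \<in> B. b \<preceq> m + var_exponent i" if "i \<in> V" for i
    proof -
      let ?x = "Poly_Mapping.single (var_exponent i) (1::'k)"
      have "var_exponent i \<noteq> 0"
        using keys_var_exponent[of i] by auto
      hence "?x * f \<in> ?I"
        using *[of ?x] that by (simp add: S lookup_single when_def keys_var_exponent) 
      moreover have "var_exponent i + m \<in> Poly_Mapping.keys (?x * f)"
        using m(1) by (simp add: in_keys_iff lookup_single_times)
      ultimately show ?thesis by (auto simp: monomial_ideal_def add.commute)
    qed
    moreover have "Poly_Mapping.keys m \<subseteq> V" using m(1) f by (simp add: S)
    ultimately show ?R using m(2) by blast
  next
    assume ?R
    then obtain m where m: "Poly_Mapping.keys m \<subseteq> V" "\<not> (\<exists>b \<in> B. b \<preceq> m)"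
      "\<And>i. i \<in> V \<Longrightarrow> \<exists>b \<in> B. b \<preceq> m + var_exponent i" by blast
    let ?f = "Poly_Mapping.single m (1::'k)"
    have f: "?f \<in> carrier S" using m(1) by (simp add: S)
    have "r * ?f \<in> ?I \<longleftrightarrow> Poly_Mapping.lookup r 0 = 0" if r: "r \<in> carrier S" for r
    proof
      assume "r * ?f \<in> ?I"
      hence "m \<notin> Poly_Mapping.keys (r * ?f)" using m(2) by (auto simp: monomial_ideal_def)
      thus "Poly_Mapping.lookup r 0 = 0"
        using lookup_single_times[of m 1 r 0] by (simp add: in_keys_iff mult.commute)
    next
      assume r0: "Poly_Mapping.lookup r 0 = 0"
      have "\<exists>b \<in> B. b \<preceq> k" if k: "k \<in> Poly_Mapping.keys (r * ?f)" for k
      proof -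
        obtain a where a: "a \<in> Poly_Mapping.keys r" "k = a + m"
          using Poly_Mapping.keys_mult[of r ?f] k by auto
        hence "a \<noteq> 0" using r0 by (auto simp: in_keys_iff)
        then obtain i where i: "i \<in> Poly_Mapping.keys a" using keys_eq_empty[of a] by blast
        hence "i \<in> V" using a(1) r by (auto simp: S)
        then obtain b where b: "b \<in> B" "b \<preceq> m + var_exponent i" using m(3) by blast
        have "m + var_exponent i \<preceq> k"
          using i by (auto simp: a(2) le_fun_def lookup_add lookup_var_exponent in_keys_iff Suc_le_eq)
        thus ?thesis using b order.trans by blast
      qed
      moreover have "r * ?f \<in> carrier S"
        using S.m_closed[OF r f] by (simp only: S polynomial_ring_simps)
      ultimately show "r * ?f \<in> ?I" by (simp add: monomial_ideal_def S)
    qed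
    thus "\<exists>f \<in> carrier S. {p \<in> carrier S. Poly_Mapping.lookup p 0 = 0} = {r \<in> carrier S. r * f \<in> ?I}"
      using f by blast
  qed
  finally show ?thesis .
qed

section \<open>Products of two intersecting sets\<close>

definition set_exponent :: "nat set \<Rightarrow> nat \<Rightarrow>\<^sub>0 nat" where
  "set_exponent W = (\<Sum>j\<in>W. var_exponent j)"

lemma lookup_set_exponent:
  "finite W \<Longrightarrow> Poly_Mapping.lookup (set_exponent W) j = (if j \<in> W then 1 else 0)"
  by (simp add: set_exponent_def lookup_sum lookup_var_exponent)

lemma keys_set_exponent: "finite W \<Longrightarrow> Poly_Mapping.keys (set_exponent W) = W"
  by (auto simp: in_keys_iff lookup_set_exponent split: if_splits)

lemma pvar_prod_eq: "finite W \<Longrightarrow> pvar_prod W = Poly_Mapping.single (set_exponent W) 1"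
  by (induction W rule: finite_induct)
    (simp_all add: pvar_prod_def set_exponent_def pvar_def var_exponent_def mult_single)

text \<open>
  Generators here are the products of two squarefree monomials, of members of an intersecting
  family. Given the condition on the right, \<open>m\<close> can be the product of all variables: it is
  squarefree, so no product of two intersecting members divides it, and multiplying it by \<open>x\<^sub>k\<close>
  makes room for a pair that meets in \<open>k\<close> only.

  Conversely, let \<open>m\<close> be any witness. A generator that divides \<open>x\<^sub>k \<cdot> m\<close> but not \<open>m\<close> has a larger
  exponent at \<open>k\<close> than \<open>m\<close>, and that exponent is at most \<open>2\<close>; so each variable occurs in \<open>m\<close> at most
  once. The two members behind this generator cannot meet in any \<open>l \<noteq> k\<close>, since there the exponent
  of \<open>m\<close> would have to be at least \<open>2\<close>.
\<close>

lemma exists_socle_exponent_iff: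
  assumes V: "finite V" and N: "\<And>i. i \<in> A \<Longrightarrow> N i \<subseteq> V"
    and meet: "\<And>i j. i \<in> A \<Longrightarrow> j \<in> A \<Longrightarrow> N i \<inter> N j \<noteq> {}"
    and B: "B = {set_exponent (N i) + set_exponent (N j) | i j. i \<in> A \<and> j \<in> A}"
  shows "(\<exists>m. Poly_Mapping.keys m \<subseteq> V \<and> \<not> (\<exists>b \<in> B. b \<preceq> m) \<and>
           (\<forall>k \<in> V. \<exists>b \<in> B. b \<preceq> m + var_exponent k))
    \<longleftrightarrow> (\<forall>k \<in> V. \<exists>i \<in> A. \<exists>j \<in> A. N i \<inter> N j = {k})"
    (is "?L \<longleftrightarrow> ?R")
proof
  have fin: "finite (N i)" if "i \<in> A" for i using N[OF that] V by (rule finite_subset)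
  have look: "Poly_Mapping.lookup (set_exponent (N i) + set_exponent (N j)) l =
      (if l \<in> N i then 1 else 0) + (if l \<in> N j then 1 else 0)" if "i \<in> A" "j \<in> A" for i j l
    using that fin by (simp add: lookup_add lookup_set_exponent)
  {
    assume ?L
    then obtain m where m: "\<And>b. b \<in> B \<Longrightarrow> \<not> b \<preceq> m"
      "\<And>k. k \<in> V \<Longrightarrow> \<exists>b \<in> B. b \<preceq> m + var_exponent k" by blast
    \<comment> \<open>The first half bounds the exponents of \<open>m\<close>; the second, applied with that bound, forces the
      common points of the pair into \<open>{k}\<close>.\<close>
    have ex: "\<exists>i \<in> A. \<exists>j \<in> A. Poly_Mapping.lookup m k < 2 \<and>
        (\<forall>l \<in> N i \<inter> N j. l \<noteq> k \<longrightarrow> 2 \<le> Poly_Mapping.lookup m l)"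
      if k: "k \<in> V" for k
    proof -
      obtain i j where ij: "i \<in> A" "j \<in> A"
        and le: "set_exponent (N i) + set_exponent (N j) \<preceq> m + var_exponent k"
        using m(2)[OF k] B by blast
      let ?b = "set_exponent (N i) + set_exponent (N j)"
      have le': "Poly_Mapping.lookup ?b l \<le> Poly_Mapping.lookup m l" if "l \<noteq> k" for l
        using le that by (simp add: le_fun_def lookup_add[of m] lookup_var_exponent) (metis add_0_right)
      have "\<not> ?b \<preceq> m" using m(1) ij B by blast
      then obtain l where "\<not> Poly_Mapping.lookup ?b l \<le> Poly_Mapping.lookup m l" by (auto simp: le_fun_def)
      hence "\<not> Poly_Mapping.lookup ?b k \<le> Poly_Mapping.lookup m k" using le'[of l] by (cases "l = k") auto
      moreover have "Poly_Mapping.lookup ?b k \<le> 2" using ij by (simp add: look)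
      ultimately have "Poly_Mapping.lookup m k < 2" by linarith
      moreover have "2 \<le> Poly_Mapping.lookup m l" if "l \<in> N i \<inter> N j" "l \<noteq> k" for l
        using le'[OF that(2)] that(1) ij by (simp add: look)
      ultimately show ?thesis using ij by blast
    qed
    show ?R
    proof
      fix k assume "k \<in> V"
      then obtain i j where ij: "i \<in> A" "j \<in> A" "\<forall>l \<in> N i \<inter> N j. l \<noteq> k \<longrightarrow> 2 \<le> Poly_Mapping.lookup m l"
        using ex by blast
      have "N i \<inter> N j \<subseteq> {k}"
      proof
        fix l assume l: "l \<in> N i \<inter> N j"
        hence "Poly_Mapping.lookup m l < 2" using ex[of l] N[OF ij(1)] by blast
        thus "l \<in> {k}" using ij(3) l by force
      qed
      hence "N i \<inter> N j = {k}" using meet[OF ij(1,2)] by (metis subset_singletonD)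
      thus "\<exists>i \<in> A. \<exists>j \<in> A. N i \<inter> N j = {k}" using ij by blast
    qed
  }
  {
    assume R: ?R
    let ?m = "set_exponent V"
    have "\<not> b \<preceq> ?m" if b: "b \<in> B" for b
    proof -
      obtain i j where ij: "i \<in> A" "j \<in> A" "b = set_exponent (N i) + set_exponent (N j)"
        using b B by blast
      obtain l where "l \<in> N i" "l \<in> N j" using meet[OF ij(1,2)] by blast
      hence "Poly_Mapping.lookup b l = 2" using look[OF ij(1,2)] by (simp add: ij(3))
      moreover have "Poly_Mapping.lookup ?m l \<le> 1" by (simp add: lookup_set_exponent[OF V])
      ultimately show ?thesis using le_funD[of "Poly_Mapping.lookup b" "Poly_Mapping.lookup ?m" l] by force
    qed
    moreover have "\<exists>b \<in> B. b \<preceq> ?m + var_exponent k" if k: "k \<in> V" for k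
    proof -
      obtain i j where ij: "i \<in> A" "j \<in> A" "N i \<inter> N j = {k}" using R k by blast
      have "Poly_Mapping.lookup (set_exponent (N i) + set_exponent (N j)) l
          \<le> Poly_Mapping.lookup (?m + var_exponent k) l" for l
      proof -
        have "l \<in> N i \<and> l \<in> N j \<longleftrightarrow> l = k" using ij(3) by (metis Int_iff singleton_iff)
        moreover have "l \<in> N i \<or> l \<in> N j \<Longrightarrow> l \<in> V" using N ij(1,2) by blast
        ultimately show ?thesis
          unfolding look[OF ij(1,2)]
          by (auto simp: lookup_add lookup_set_exponent[OF V] lookup_var_exponent)
      qed
      thus ?thesis using ij B by (auto simp: le_fun_def)
    qed
    ultimately show ?L using keys_set_exponent[OF V] by blast
  }
qed


section \<open>The square of the closed neighborhood ideal\<close>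

lemma closed_nbhd_ideal_square:
  fixes G :: "(nat, 'e) pre_digraph" and S :: "('k::field) polynomial ring"
  assumes "graph G" and S: "S = polynomial_ring (verts G)"
  shows "closed_nbhd_ideal G \<cdot>\<^bsub>S\<^esub> closed_nbhd_ideal G =
    monomial_ideal (verts G)
      {set_exponent (closed_nbhd G i) + set_exponent (closed_nbhd G j) | i j. i \<in> verts G \<and> j \<in> verts G}"
proof -
  interpret graph G by fact
  let ?A = "(\<lambda>i. set_exponent (closed_nbhd G i)) ` verts G"
  have sub: "closed_nbhd G i \<subseteq> verts G" if "i \<in> verts G" for i
    using closed_nbhd_subset[OF wf_digraph that] .
  have fin: "finite (closed_nbhd G i)" if "i \<in> verts G" for i
    using sub[OF that] finite_verts by (rule finite_subset)
  have keys: "Poly_Mapping.keys a \<subseteq> verts G" if a: "a \<in> ?A" for a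
  proof -
    obtain i where i: "i \<in> verts G" "a = set_exponent (closed_nbhd G i)" using a by blast
    show ?thesis using sub[OF i(1)] by (simp add: i(2) keys_set_exponent[OF fin[OF i(1)]])
  qed
  have "(\<lambda>i. pvar_prod (closed_nbhd G i)) ` verts G =
      (\<lambda>a. Poly_Mapping.single a (1::'k)) ` ?A"
    unfolding image_image by (intro image_cong refl pvar_prod_eq fin)
  hence "(closed_nbhd_ideal G :: 'k polynomial set) =
      Idl\<^bsub>S\<^esub> ((\<lambda>a. Poly_Mapping.single a (1::'k)) ` ?A)"
    by (simp only: closed_nbhd_ideal_def S)
  also have "\<dots> = monomial_ideal (verts G) ?A"
    unfolding S by (rule genideal_monomials) (rule keys)
  finally have "closed_nbhd_ideal G = (monomial_ideal (verts G) ?A :: 'k polynomial set)" .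
  moreover have "(monomial_ideal (verts G) ?A :: 'k polynomial set) \<cdot>\<^bsub>S\<^esub> monomial_ideal (verts G) ?A =
      monomial_ideal (verts G) {a + b | a b. a \<in> ?A \<and> b \<in> ?A}"
    unfolding S by (rule ideal_prod_monomial_ideals) (rule keys, assumption)+
  moreover have "{a + b | a b. a \<in> ?A \<and> b \<in> ?A} =
      {set_exponent (closed_nbhd G i) + set_exponent (closed_nbhd G j) | i j. i \<in> verts G \<and> j \<in> verts G}"
    by blast
  ultimately show ?thesis by simp
qed

theorem theorem1p3:
  fixes G :: "(nat, 'e) pre_digraph" and n :: nat
    and S :: "('k::field) polynomial ring" and NI \<mm> :: "'k polynomial set"
  assumes "graph G" and "verts G = {1..n}" and "n \<ge> 2"
    and "gdiam G \<le> 2"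
    and "S = polynomial_ring {1..n}"
    and "\<mm> = Idl\<^bsub>S\<^esub> (pvar ` {1..n})"
    and "NI = closed_nbhd_ideal G"
  shows "associated_prime S (quotient_module S (NI \<cdot>\<^bsub>S\<^esub> NI)) \<mm>
         \<longleftrightarrow> vertex_diameter_critical 2 G"
proof -
  interpret graph G by fact
  have sym: "sym_digraph G" by unfold_locales
  let ?B = "{set_exponent (closed_nbhd G i) + set_exponent (closed_nbhd G j) | i j.
    i \<in> verts G \<and> j \<in> verts G}"
  have S: "S = polynomial_ring (verts G)" using assms(2,5) by simp
  have "associated_prime S (quotient_module S (NI \<cdot>\<^bsub>S\<^esub> NI)) \<mm> \<longleftrightarrow>
      (\<exists>m. Poly_Mapping.keys m \<subseteq> verts G \<and> \<not> (\<exists>b \<in> ?B. b \<preceq> m) \<and>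
         (\<forall>k \<in> verts G. \<exists>b \<in> ?B. b \<preceq> m + var_exponent k))"
    unfolding assms(6,7) closed_nbhd_ideal_square[OF assms(1) S] assms(2)[symmetric]
    by (rule maximal_ideal_associated_iff[OF S])
  also have "\<dots> \<longleftrightarrow> (\<forall>k \<in> verts G. \<exists>i \<in> verts G. \<exists>j \<in> verts G. closed_nbhd G i \<inter> closed_nbhd G j = {k})"
  proof (rule exists_socle_exponent_iff[OF finite_verts _ _ refl])
    show "closed_nbhd G i \<subseteq> verts G" if "i \<in> verts G" for i
      using closed_nbhd_subset[OF wf_digraph that] .
    show "closed_nbhd G i \<inter> closed_nbhd G j \<noteq> {}" if "i \<in> verts G" "j \<in> verts G" for i j
      using assms(4) that unfolding gdiam_le_2_iff[OF sym] by blast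
  qed
  also have "\<dots> \<longleftrightarrow> vertex_diameter_critical 2 G"
    by (rule vertex_diameter_2_critical_iff[symmetric, OF assms(1) _ _ _ assms(4), of 1 n])
      (use assms(2,3) in auto)
  finally show ?thesis .
qed

end
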